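(* Let $\Phi$ be a Young function such that $$\lim_{t\to \infty}\frac{\Phi(t)}{t\log\log (\mathrm{e}^{\mathrm{e}}+t)}=0.$$ Then for every $c>0$ there exist a function $f$ on $\mathbb{R}$, a weight $w$ on $\mathbb{R}$ and $\lambda>0$ such that $$w\{x\in \mathbb{R}:|Hf(x)|>\lambda\}>\frac{c}{\lambda}\int_{\mathbb{R}}|f|\,M_{\Phi}w\,dx.$$
   Context: A weight is a non-negative measurable function $w$ on $\mathbb{R}$, and $w(E)=\int_E w\,dx$ (so $w\{\dots\}$ is the integral of $w$ over the set $\{\dots\}$). $H$ denotes the Hilbert transform on $\mathbb{R}$ (the principal value convolution with $1/x$, up to the usual normalizing constant). A Young function is a continuous, convex, increasing function $\Phi:[0,\infty)\to[0,\infty)$ with $\Phi(0)=0$ and $\Phi(t)\to\infty$ as $t\to\infty$ (in particular $\Phi(t)=t$ is allowed). The Orlicz maximal operator $M_\Phi$ is defined by $$M_{\Phi}f(x)=\sup_{I\ni x}\inf\left\{\lambda>0:\frac{1}{|I|}\int_I\Phi\left(\frac{|f(y)|}{\lambda}\right)dy\le 1\right\},$$ where the supremum is over all bounded intervals $I\subset\mathbb{R}$ containing $x$. The functions $f$ considered are those with $\int_{\mathbb{R}}|f|M_\Phi w\,dx<\infty$, i.e. $f\in L^1(M_\Phi w)$. *)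

theory Defs
  imports "HOL-Analysis.Analysis"
begin

definition weight :: "(real \<Rightarrow> real) \<Rightarrow> bool" where
  "weight w \<longleftrightarrow> w \<in> borel_measurable lebesgue \<and> (\<forall>x. 0 \<le> w x)"

definition weight_of :: "(real \<Rightarrow> real) \<Rightarrow> real set \<Rightarrow> ennreal" where
  "weight_of w E = (\<integral>\<^sup>+x\<in>E. ennreal (w x) \<partial>lebesgue)"

(* Only the values of Phi on [0,oo) matter. "Increasing" is read as non-decreasing. *)
definition young_function :: "(real \<Rightarrow> real) \<Rightarrow> bool" where
  "young_function \<Phi> \<longleftrightarrow>
     \<Phi> \<in> {0..} \<rightarrow> {0..} \<and>
     continuous_on {0..} \<Phi> \<and> convex_on {0..} \<Phi> \<and> mono_on {0..} \<Phi> \<and>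
     \<Phi> 0 = 0 \<and> filterlim \<Phi> at_top at_top"

(* The norm takes values in [0,oo]; it is oo when no lambda is admissible. *)
definition luxemburg_norm :: "(real \<Rightarrow> real) \<Rightarrow> real set \<Rightarrow> (real \<Rightarrow> real) \<Rightarrow> ennreal" where
  "luxemburg_norm \<Phi> I f =
     Inf {ennreal l | l. 0 < l \<and>
       (\<integral>\<^sup>+y\<in>I. ennreal (\<Phi> (\<bar>f y\<bar> / l)) \<partial>lebesgue) / emeasure lebesgue I \<le> 1}"

definition orlicz_maximal :: "(real \<Rightarrow> real) \<Rightarrow> (real \<Rightarrow> real) \<Rightarrow> real \<Rightarrow> ennreal" where
  "orlicz_maximal \<Phi> f x =
     (SUP I \<in> {I. is_interval I \<and> bounded I \<and> 0 < emeasure lebesgue I \<and> x \<in> I}.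
        luxemburg_norm \<Phi> I f)"

definition truncated_hilbert :: "real \<Rightarrow> (real \<Rightarrow> real) \<Rightarrow> real \<Rightarrow> real" where
  "truncated_hilbert \<epsilon> f x =
     (1 / pi) * (LINT y:{y. \<epsilon> < \<bar>x - y\<bar>}|lebesgue. f y / (x - y))"

(* The integrability clause excludes points where a truncated integral diverges and
   the Bochner integral is therefore 0 by convention. *)
definition has_hilbert_transform :: "(real \<Rightarrow> real) \<Rightarrow> real \<Rightarrow> real \<Rightarrow> bool" where
  "has_hilbert_transform f x l \<longleftrightarrow>
     (\<forall>\<epsilon>>0. set_integrable lebesgue {y. \<epsilon> < \<bar>x - y\<bar>} (\<lambda>y. f y / (x - y))) \<and>
     ((\<lambda>\<epsilon>. truncated_hilbert \<epsilon> f x) \<longlongrightarrow> l) (at_right 0)"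

(* By convention 0 where the principal value does not exist, so that such points
   never belong to a set of the form {|Hf| > lambda} with lambda > 0. *)
definition hilbert_transform :: "(real \<Rightarrow> real) \<Rightarrow> real \<Rightarrow> real" where
  "hilbert_transform f x =
     (if \<exists>l. has_hilbert_transform f x l then THE l. has_hilbert_transform f x l else 0)"

end

theory Submission
  imports Defs "HOL-Real_Asymp.Real_Asymp"
begin

text \<open>The weight is the uniform probability measure on a Cantor-like set and \<open>f\<close> is a sum of
small dipoles placed at the edges of its gaps. Fix a large \<open>M\<close> and let a cell of level \<open>n\<close>
be an interval of length \<open>(3M)^(-n)\<close> whose left endpoint has only the middle digits
\<open>M, ..., 2M - 1\<close> in its \<open>n\<close>-digit base \<open>3M\<close> expansion. The cells of level \<open>n + 1\<close> tile
the middle third (the core) of each cell of level \<open>n\<close>. The weight \<open>w\<close> lives on the cores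
of the cells of level \<open>M\<close>, so its average over a cell of level \<open>n\<close> is \<open>3^n\<close>.
The function \<open>f\<close> puts, for every cell of each level \<open>n < M\<close>, the value \<open>1\<close> on a short interval
left of its core and \<open>-1\<close> on one right of it, each of length \<open>(3M)^(-n) / (9M)\<close>.

\<^item> On the dipole of a cell of level \<open>n\<close> the maximal function is at most \<open>A 3^n\<close>, where \<open>A\<close> is of the
order of \<open>1 + \<Phi>(T)/T\<close> with \<open>T = 3^(M+1)\<close> the height of \<open>w\<close>. Indeed \<open>w\<close> vanishes close to the
dipole, so that an interval through it has to reach the scale of level \<open>n + 1\<close> before it meets \<open>w\<close>,
and from that scale on the averages of \<open>w\<close> are \<open>O(3^n)\<close>. The cells of level \<open>n\<close> have
total length \<open>3^(-n)\<close>, whence \<open>\<integral>|f| M_\<Phi> w \<le> 2A/9\<close> (\<open>dipoles_norm_le\<close>).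
Since \<open>ln ln T\<close> is comparable to \<open>ln M\<close>, the growth hypothesis says that \<open>A = o(ln M)\<close>.

\<^item> At a point of the support whose expansion has the digits \<open>M + d_0, M + d_1, ...\<close>, the dipole of the
surrounding cell of level \<open>n\<close> contributes at least \<open>1 / (3 (d_n + 1))\<close> to \<open>\<pi> Hf\<close>. All other
dipoles of that level together contribute at least \<open>-4/(9M)\<close>, because the potential of a dipole
decays quadratically. So \<open>\<pi> Hf \<ge> (\<Sum>n<M. 1 / (d_n + 1)) / 3 - 1\<close> (\<open>hilbert_transform_dipoles_ge\<close>).

\<^item> Under \<open>w\<close> the digits are independent and uniform, and the sum of the \<open>1 / (d_n + 1)\<close> has mean
\<open>1 + 1/2 + ... + 1/M \<ge> ln M\<close>. An exponential moment estimate shows that it exceeds \<open>ln M - 2\<close> with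
probability at least one half (\<open>card_large_digit_sum\<close>).

Hence \<open>|Hf|\<close> exceeds a constant multiple of \<open>ln M\<close> on half of the mass of \<open>w\<close>, while
\<open>\<integral>|f| M_\<Phi> w\<close> is \<open>o(ln M)\<close>: no constant \<open>c\<close> works for all \<open>M\<close>.\<close>

section \<open>Hilbert transforms of sums of interval indicators\<close>

lemma hilbert_transform_eq:
  assumes "has_hilbert_transform f x l"
  shows "hilbert_transform f x = l"
proof -
  have "(THE l. has_hilbert_transform f x l) = l"
    using assms
    by (intro the_equality) (auto simp: has_hilbert_transform_def intro: tendsto_unique[OF trivial_limit_at_right_real])
  then show ?thesis using assms by (auto simp: hilbert_transform_def)
qed

lemma has_hilbert_transform_diff:
  assumes "has_hilbert_transform f x a" "has_hilbert_transform g x b"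
  shows "has_hilbert_transform (\<lambda>y. f y - g y) x (a - b)"
proof -
  have eq: "truncated_hilbert \<epsilon> (\<lambda>y. f y - g y) x = truncated_hilbert \<epsilon> f x - truncated_hilbert \<epsilon> g x"
    if "\<epsilon> > 0" for \<epsilon>
    using assms that
    by (simp add: truncated_hilbert_def has_hilbert_transform_def diff_divide_distrib right_diff_distrib)
  have "((\<lambda>\<epsilon>. truncated_hilbert \<epsilon> f x - truncated_hilbert \<epsilon> g x) \<longlongrightarrow> a - b) (at_right 0)"
    using assms by (intro tendsto_diff) (auto simp: has_hilbert_transform_def)
  moreover have "\<forall>\<^sub>F \<epsilon> in at_right 0. truncated_hilbert \<epsilon> (\<lambda>y. f y - g y) x
      = truncated_hilbert \<epsilon> f x - truncated_hilbert \<epsilon> g x"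
    by (rule eventually_at_right_less[THEN eventually_mono]) (rule eq)
  ultimately have "((\<lambda>\<epsilon>. truncated_hilbert \<epsilon> (\<lambda>y. f y - g y) x) \<longlongrightarrow> a - b) (at_right 0)"
    by (simp add: tendsto_cong)
  then show ?thesis
    using assms by (simp add: has_hilbert_transform_def diff_divide_distrib)
qed

lemma has_hilbert_transform_zero: "has_hilbert_transform (\<lambda>y. 0) x 0"
  by (simp add: has_hilbert_transform_def truncated_hilbert_def set_integrable_def)

lemma has_hilbert_transform_sum:
  assumes "finite S" "\<And>s. s \<in> S \<Longrightarrow> has_hilbert_transform (f s) x (a s)"
  shows "has_hilbert_transform (\<lambda>y. \<Sum>s\<in>S. f s y) x (\<Sum>s\<in>S. a s)"
  using assms
proof (induction S rule: finite_induct)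
  case empty
  then show ?case by (simp add: has_hilbert_transform_zero)
next
  case (insert s S)
  have "has_hilbert_transform (\<lambda>y. f s y - (0 - (\<Sum>s\<in>S. f s y))) x (a s - (0 - (\<Sum>s\<in>S. a s)))"
    using insert by (intro has_hilbert_transform_diff has_hilbert_transform_zero) auto
  then show ?case using insert by simp
qed

lemma set_integrable_cauchy_kernel:
  fixes x a b :: real
  assumes "x \<notin> {a..b}"
  shows "set_integrable lebesgue {a..b} (\<lambda>y. 1 / (x - y))"
proof -
  have "set_integrable lborel {a..b} (\<lambda>y. 1 / (x - y))"
    using assms by (intro borel_integrable_atLeastAtMost' continuous_intros) auto
  then show ?thesis
    unfolding set_integrable_def by (intro integrable_completion[THEN iffD2]) auto
qed

text \<open>Away from the interval the principal value is an ordinary integral: the truncation no longer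
affects it once \<open>\<epsilon>\<close> is below the distance to the interval.\<close>

lemma has_hilbert_transform_indicator:
  fixes x a b :: real
  assumes x: "x \<notin> {a..b}"
  shows "has_hilbert_transform (indicator {a..b}) x (1 / pi * (LINT y:{a..b}|lebesgue. 1 / (x - y)))"
proof -
  let ?k = "\<lambda>y. indicator {a..b} y / (x - y)"
  have i: "integrable lebesgue ?k"
    using set_integrable_cauchy_kernel[OF x] by (simp add: set_integrable_def)
  have "set_integrable lebesgue {y. \<epsilon> < \<bar>x - y\<bar>} ?k" for \<epsilon>
    unfolding set_integrable_def using i by (intro integrable_mult_indicator) auto
  moreover obtain \<delta> where \<delta>: "\<delta> > 0" "\<And>y. y \<in> {a..b} \<Longrightarrow> \<delta> \<le> dist x y"
    using separate_point_closed[of "{a..b}" x] x by auto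
  have "truncated_hilbert \<epsilon> (indicator {a..b}) x = 1 / pi * (LINT y:{a..b}|lebesgue. 1 / (x - y))"
    if "\<epsilon> < \<delta>" for \<epsilon>
    unfolding truncated_hilbert_def set_lebesgue_integral_def
    using \<delta>(2) that by (intro arg_cong2[of _ _ _ _ "(*)"] Bochner_Integration.integral_cong refl)
      (force simp: dist_real_def split: split_indicator)
  then have "\<forall>\<^sub>F \<epsilon> in at_right 0. truncated_hilbert \<epsilon> (indicator {a..b}) x
      = 1 / pi * (LINT y:{a..b}|lebesgue. 1 / (x - y))"
    using eventually_at_right_field \<delta>(1) by blast
  ultimately show ?thesis
    unfolding has_hilbert_transform_def by (auto intro: tendsto_eventually)
qed

text \<open>The kernel \<open>1 / (x - y)\<close> is increasing in \<open>y\<close> on both sides of its pole, so the same two bounds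
serve for \<open>x\<close> to the left and to the right of the interval.\<close>

lemma cauchy_kernel_integral_bounds:
  fixes x a b :: real
  assumes x: "x \<notin> {a..b}" and ab: "a \<le> b"
  shows "(b - a) / (x - a) \<le> (LINT y:{a..b}|lebesgue. 1 / (x - y))"
    and "(LINT y:{a..b}|lebesgue. 1 / (x - y)) \<le> (b - a) / (x - b)"
proof -
  have c: "(LINT y:{a..b}|lebesgue. t) = (b - a) * t" "set_integrable lebesgue {a..b} (\<lambda>y. t)" for t :: real
    using ab by (auto simp: set_lebesgue_integral_def set_integrable_def)
  have k: "1 / (x - a) \<le> 1 / (x - y)" "1 / (x - y) \<le> 1 / (x - b)" if "y \<in> {a..b}" for y
    using x that ab by (auto simp: divide_simps)
  have "(LINT y:{a..b}|lebesgue. 1 / (x - a)) \<le> (LINT y:{a..b}|lebesgue. 1 / (x - y))"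
    by (intro set_integral_mono c set_integrable_cauchy_kernel x k)
  then show "(b - a) / (x - a) \<le> (LINT y:{a..b}|lebesgue. 1 / (x - y))" by (simp add: c)
  have "(LINT y:{a..b}|lebesgue. 1 / (x - y)) \<le> (LINT y:{a..b}|lebesgue. 1 / (x - b))"
    by (intro set_integral_mono c set_integrable_cauchy_kernel x k)
  then show "(LINT y:{a..b}|lebesgue. 1 / (x - y)) \<le> (b - a) / (x - b)" by (simp add: c)
qed

section \<open>Elementary inequalities\<close>

lemma interval_lmeasurable:
  fixes I :: "real set"
  assumes "is_interval I" "bounded I"
  shows "I \<in> lmeasurable"
proof (rule bounded_set_imp_lmeasurable)
  show "I \<in> sets lebesgue"
    using real_interval_borel_measurable[OF assms(1)] by simp
qed (rule assms)

lemma diff_le_measure_interval: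
  fixes I :: "real set"
  assumes "is_interval I" "bounded I" "x \<in> I" "y \<in> I"
  shows "y - x \<le> measure lebesgue I"
proof (cases "x \<le> y")
  case True
  have "I \<in> lmeasurable"
    using assms by (intro interval_lmeasurable)
  moreover have "{x..y} \<subseteq> I"
    using mem_is_interval_1_I[OF assms(1,3,4)] by force
  ultimately have "measure lebesgue {x..y} \<le> measure lebesgue I"
    by (intro measure_mono_fmeasurable) auto
  then show ?thesis using True by simp
next
  case False
  then show ?thesis using measure_nonneg[of lebesgue I] by linarith
qed

text \<open>The product of \<open>1 - z + z^2/2\<close> with \<open>1 + z + z^2/2 \<le> exp z\<close> is \<open>1 + z^4/4 \<ge> 1\<close>.\<close>

lemma exp_minus_le:
  assumes "0 \<le> (z::real)"
  shows "exp (- z) \<le> 1 - z + z\<^sup>2 / 2"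
proof -
  have "1 + z + z\<^sup>2 / 2 \<le> exp z" using exp_lower_Taylor_quadratic[OF assms] by simp
  moreover have pos: "0 < 1 + z + z\<^sup>2 / 2"
    using assms by (simp add: add_pos_nonneg)
  ultimately have "exp (- z) \<le> 1 / (1 + z + z\<^sup>2 / 2)"
    by (simp add: exp_minus inverse_eq_divide frac_le)
  also have "\<dots> \<le> 1 - z + z\<^sup>2 / 2"
  proof -
    have "(1 - z + z\<^sup>2 / 2) * (1 + z + z\<^sup>2 / 2) = 1 + z^4 / 4"
      by (simp add: power4_eq_xxxx power2_eq_square field_simps)
    then show ?thesis using pos by (simp add: divide_le_eq)
  qed
  finally show ?thesis .
qed

lemma sum_inverse_squares_le: "(\<Sum>m\<in>{1..n}. 1 / (real m)\<^sup>2) \<le> 2"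
proof -
  have "(\<Sum>m\<in>{1..Suc n}. 1 / (real m)\<^sup>2) \<le> 2 - 1 / real (Suc n)"
  proof (induction n)
    case (Suc n)
    have "1 / (real (Suc n) + 1)\<^sup>2 \<le> 1 / (real (Suc n) * (real (Suc n) + 1))"
      by (intro divide_left_mono) (auto simp: power2_eq_square)
    also have "\<dots> = 1 / real (Suc n) - 1 / (real (Suc n) + 1)"
      by (simp add: divide_simps)
    finally have "1 / (real (Suc n) + 1)\<^sup>2 \<le> 1 / real (Suc n) - 1 / (real (Suc n) + 1)" .
    then show ?case using Suc by (simp add: add_ac)
  qed simp
  moreover have "(\<Sum>m\<in>{1..n}. 1 / (real m)\<^sup>2) \<le> (\<Sum>m\<in>{1..Suc n}. 1 / (real m)\<^sup>2)"
    by (intro sum_mono2) auto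
  moreover have "1 / real (Suc n) \<ge> 0" by simp
  ultimately show ?thesis by linarith
qed

lemma sum_inverse_square_distances_le:
  fixes S :: "nat set"
  assumes "finite S"
  shows "(\<Sum>k\<in>S - {k0}. 1 / (real k - real k0)\<^sup>2) \<le> 4"
proof -
  obtain B where B: "\<And>k. k \<in> S \<Longrightarrow> k \<le> B" using assms finite_nat_set_iff_bounded_le by auto
  have half: "(\<Sum>k\<in>U. 1 / (real k - real k0)\<^sup>2) \<le> 2"
    if inj: "inj_on g U" and im: "g ` U \<subseteq> {1..B + k0}"
      and g: "\<And>k. k \<in> U \<Longrightarrow> (real k - real k0)\<^sup>2 = (real (g k))\<^sup>2" for g U
  proof -
    have "(\<Sum>k\<in>U. 1 / (real k - real k0)\<^sup>2) = (\<Sum>m\<in>g ` U. 1 / (real m)\<^sup>2)"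
      using g by (simp add: sum.reindex[OF inj])
    also have "\<dots> \<le> (\<Sum>m\<in>{1..B + k0}. 1 / (real m)\<^sup>2)"
      using im by (intro sum_mono2) auto
    also have "\<dots> \<le> 2" by (rule sum_inverse_squares_le)
    finally show ?thesis .
  qed
  have "S - {k0} = {k\<in>S. k0 < k} \<union> {k\<in>S. k < k0}" by auto
  then have "(\<Sum>k\<in>S - {k0}. 1 / (real k - real k0)\<^sup>2)
      = (\<Sum>k | k \<in> S \<and> k0 < k. 1 / (real k - real k0)\<^sup>2) + (\<Sum>k | k \<in> S \<and> k < k0. 1 / (real k - real k0)\<^sup>2)"
    using assms by (simp add: sum.union_disjoint disjoint_iff)
  moreover have "(\<Sum>k | k \<in> S \<and> k0 < k. 1 / (real k - real k0)\<^sup>2) \<le> 2"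
    using B by (intro half[of "\<lambda>k. k - k0"]) (force simp: inj_on_def of_nat_diff)+
  moreover have "(\<Sum>k | k \<in> S \<and> k < k0. 1 / (real k - real k0)\<^sup>2) \<le> 2"
    using B by (intro half[of "\<lambda>k. k0 - k"]) (force simp: inj_on_def of_nat_diff power2_commute)+
  ultimately show ?thesis by linarith
qed

text \<open>The potential of a dipole at a distant point, in units of its cell: the poles lie at \<open>m + 1/3 - e\<close>
and \<open>m + 2/3 + e\<close>, and the point \<open>v\<close> is in the core of the cell \<open>[0, 1]\<close>. Writing the potential as
\<open>-(a - b) / (a b)\<close>, the numerator is at most \<open>5/9\<close> and the denominator at least \<open>5/9 m^2\<close>. The
quadratic decay makes the sum over all cells of a level converge.\<close>

lemma far_dipole_bound:
  fixes v e :: real and m :: int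
  assumes v: "1/3 \<le> v" "v \<le> 2/3" and e: "0 \<le> e" "e \<le> 1/9" and m: "m \<noteq> 0"
  shows "- (1 / (real_of_int m)\<^sup>2) \<le> 1 / (v - m - 1/3 + e) - 1 / (v - m - 2/3 - e)"
proof -
  define a where "a = v - m - 1/3 + e"
  define b where "b = v - m - 2/3 - e"
  define r where "r = \<bar>real_of_int m\<bar>"
  have r: "r \<ge> 1" using m by (simp add: r_def)
  have ab: "r * (5/9 * r) \<le> a * b \<and> a \<noteq> 0 \<and> b \<noteq> 0"
  proof (cases "m > 0")
    case True
    then have rm: "real_of_int m = r" by (simp add: r_def)
    have "- a \<ge> 5/9 * r" "- b \<ge> r" using r rm v e by (auto simp: a_def b_def)
    then have "5/9 * r * r \<le> (- a) * (- b)" using r by (intro mult_mono) auto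
    then show ?thesis using \<open>- a \<ge> 5/9 * r\<close> \<open>- b \<ge> r\<close> r by auto
  next
    case False
    then have rm: "real_of_int m = - r" by (simp add: r_def)
    have "a \<ge> r" "b \<ge> 5/9 * r" using r rm v e by (auto simp: a_def b_def)
    then have "r * (5/9 * r) \<le> a * b" using r by (intro mult_mono) auto
    then show ?thesis using \<open>a \<ge> r\<close> \<open>b \<ge> 5/9 * r\<close> r by auto
  qed
  have "a - b \<le> 5/9" using e by (simp add: a_def b_def)
  then have "(a - b) / (a * b) \<le> (5/9) / (r * (5/9 * r))"
    using ab r e by (intro frac_le) (auto simp: a_def b_def)
  also have "\<dots> = 1 / (real_of_int m)\<^sup>2" using r by (simp add: r_def power2_eq_square)
  finally have "(a - b) / (a * b) \<le> 1 / (real_of_int m)\<^sup>2" .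
  moreover have "1 / a - 1 / b = - ((a - b) / (a * b))" using ab by (simp add: field_simps)
  ultimately show ?thesis unfolding a_def b_def by linarith
qed

section \<open>Cells, cores and flanks\<close>

locale digit_cantor =
  fixes M :: nat
  assumes M_pos: "0 < M"
begin

text \<open>A cell of level \<open>n\<close> is represented by the integer \<open>k\<close> for which it is \<open>[k, k + 1] / (3M)^n\<close>, so that
passing to the surrounding cell of level \<open>n - m\<close> is division by \<open>(3M)^m\<close>.\<close>

primrec cells :: "nat \<Rightarrow> nat set" where
  "cells 0 = {0}"
| "cells (Suc n) = (\<lambda>(k, d). 3 * M * k + (M + d)) ` (cells n \<times> {..<M})"

definition core :: "nat \<Rightarrow> nat \<Rightarrow> real set" where
  "core n k = {(real k + 1/3) / (3 * real M) ^ n .. (real k + 2/3) / (3 * real M) ^ n}"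

text \<open>The length of the flanks is a third of the length of a cell of the next level. Thus the flank of a cell
is as far from the core of its nearest child as it is long.\<close>

definition left_flank :: "nat \<Rightarrow> nat \<Rightarrow> real set" where
  "left_flank n k = {(real k + 1/3 - 1 / (9 * real M)) / (3 * real M) ^ n .. (real k + 1/3) / (3 * real M) ^ n}"

definition right_flank :: "nat \<Rightarrow> nat \<Rightarrow> real set" where
  "right_flank n k = {(real k + 2/3) / (3 * real M) ^ n .. (real k + 2/3 + 1 / (9 * real M)) / (3 * real M) ^ n}"

definition support :: "real set" where
  "support = (\<Union>p\<in>cells M. core M p)"

text \<open>The height makes the total mass \<open>1\<close>: there are \<open>M^M\<close> cores of length \<open>(3M)^(-M) / 3\<close>.\<close>

definition cantor_weight :: "real \<Rightarrow> real" where
  "cantor_weight x = 3 ^ Suc M * indicator support x"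

definition dipoles :: "real \<Rightarrow> real" where
  "dipoles x = (\<Sum>n<M. \<Sum>k\<in>cells n. indicator (left_flank n k) x - indicator (right_flank n k) x)"

text \<open>The digits are read off from the least significant one, so that appending a digit to \<open>p\<close> shifts the
summation index by one.\<close>

definition digit_sum :: "nat \<Rightarrow> nat \<Rightarrow> real" where
  "digit_sum n p = (\<Sum>j<n. 1 / (real (p div (3 * M) ^ j mod (3 * M)) - M + 1))"

lemma append_digit:
  assumes "d < M"
  shows "(3 * M * k + (M + d)) div (3 * M) = k" "(3 * M * k + (M + d)) mod (3 * M) = M + d"
proof -
  have "M + d < 3 * M" using assms by simp
  then show "(3 * M * k + (M + d)) div (3 * M) = k" "(3 * M * k + (M + d)) mod (3 * M) = M + d"
    by auto
qed

lemma inj_append_digit: "inj_on (\<lambda>(k, d). 3 * M * k + (M + d)) (A \<times> {..<M})"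
proof (rule inj_onI, clarsimp)
  fix k d k' d' assume a: "d < M" "d' < M" and e: "3 * M * k + d = 3 * M * k' + d'"
  have e': "3 * M * k + (M + d) = 3 * M * k' + (M + d')" using e by simp
  show "k = k' \<and> d = d'"
    using append_digit[OF a(1), of k] append_digit[OF a(2), of k'] e' by auto
qed

lemma finite_cells [simp]: "finite (cells n)"
  by (induction n) auto

lemma card_cells: "card (cells n) = M ^ n"
  by (induction n) (auto simp: card_image[OF inj_append_digit] card_cartesian_product)

lemma cells_div_mod:
  "p \<in> cells (n + m) \<Longrightarrow> p div (3 * M) ^ m \<in> cells n \<and> p mod (3 * M) ^ m \<in> cells m"
proof (induction m arbitrary: p)
  case 0 then show ?case by simp
next
  case (Suc m)
  then obtain q d where q: "q \<in> cells (n + m)" "d < M" "p = 3 * M * q + (M + d)" by auto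
  have dv: "p div (3 * M) ^ Suc m = q div (3 * M) ^ m"
    using q append_digit(1)[OF q(2), of q] by (simp only: power_Suc div_mult2_eq)
  have "p mod (3 * M) ^ Suc m = 3 * M * (q mod (3 * M) ^ m) + (M + d)"
    using q append_digit[OF q(2), of q] by (simp only: power_Suc mod_mult2_eq)
  then show ?case using Suc.IH[OF q(1)] q(2) dv by auto
qed

lemma card_descendants:
  "card {p \<in> cells (n + m). p div (3 * M) ^ m = k} \<le> M ^ m"
proof -
  have "inj_on (\<lambda>p. p mod (3 * M) ^ m) {p \<in> cells (n + m). p div (3 * M) ^ m = k}"
  proof (rule inj_onI)
    fix p q assume *: "p \<in> {p \<in> cells (n + m). p div (3 * M) ^ m = k}"
       "q \<in> {p \<in> cells (n + m). p div (3 * M) ^ m = k}" "p mod (3 * M) ^ m = q mod (3 * M) ^ m"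
    then show "p = q"
      by (metis (mono_tags, lifting) div_mult_mod_eq mem_Collect_eq)
  qed
  then have "card {p \<in> cells (n + m). p div (3 * M) ^ m = k} \<le> card (cells m)"
    by (rule card_inj_on_le) (use cells_div_mod in auto)
  then show ?thesis by (simp add: card_cells)
qed

lemma mem_core_iff:
  "x \<in> core n k \<longleftrightarrow> real k + 1/3 \<le> x * (3 * real M) ^ n \<and> x * (3 * real M) ^ n \<le> real k + 2/3"
  using M_pos by (simp add: core_def field_simps)

lemma core_child:
  assumes "d < M" and x: "x \<in> core (Suc n) (3 * M * k + (M + d))"
  shows "real k + 1/3 + (real d + 1/3) / (3 * real M) \<le> x * (3 * real M) ^ n"
    and "x * (3 * real M) ^ n \<le> real k + 1/3 + (real d + 2/3) / (3 * real M)"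
proof -
  have P: "real M > 0" using M_pos by simp
  have "3 * real M * (real k + 1/3) + real d + 1/3 \<le> (3 * real M) * (x * (3 * real M) ^ n)"
    and "(3 * real M) * (x * (3 * real M) ^ n) \<le> 3 * real M * (real k + 1/3) + real d + 2/3"
    using x P by (auto simp: core_def field_simps)
  then show "real k + 1/3 + (real d + 1/3) / (3 * real M) \<le> x * (3 * real M) ^ n"
    and "x * (3 * real M) ^ n \<le> real k + 1/3 + (real d + 2/3) / (3 * real M)"
    using P by (simp_all add: field_simps)
qed

lemma core_child_subset:
  assumes "d < M"
  shows "core (Suc n) (3 * M * k + (M + d)) \<subseteq> core n k"
proof
  fix x assume x: "x \<in> core (Suc n) (3 * M * k + (M + d))"
  have P: "real M > 0" using M_pos by simp
  have d: "real d + 1 \<le> real M" using assms by linarith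
  have "(real d + 1/3) / (3 * real M) \<ge> 0" by simp
  moreover have "(real d + 2/3) / (3 * real M) \<le> 1/3" using P d by (simp add: field_simps)
  ultimately show "x \<in> core n k"
    using core_child[OF assms x] unfolding mem_core_iff by linarith
qed

lemma core_ancestor:
  "p \<in> cells (n + m) \<Longrightarrow> core (n + m) p \<subseteq> core n (p div (3 * M) ^ m)"
proof (induction m arbitrary: p)
  case 0 then show ?case by simp
next
  case (Suc m)
  then obtain q d where q: "q \<in> cells (n + m)" "d < M" "p = 3 * M * q + (M + d)" by auto
  have dv: "p div (3 * M) ^ Suc m = q div (3 * M) ^ m"
    using q append_digit(1)[OF q(2), of q] by (simp only: power_Suc div_mult2_eq)
  show ?case
    using core_child_subset[OF q(2), of "n + m" q] Suc.IH[OF q(1)] q(3) dv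
    by (metis add_Suc_right subset_trans)
qed

text \<open>The position of a point of the support inside its cell of level \<open>n\<close>, up to a third of the
length of a cell of level \<open>n + 1\<close>. The
lower bound keeps the support away from the flanks, the upper bound makes the kernel large when \<open>d\<close>
is small.\<close>

lemma core_locate_child:
  assumes p: "p \<in> cells M" and x: "x \<in> core M p" and M: "M = n + Suc m"
  obtains k d where "k \<in> cells n" "d < M" "p div (3 * M) ^ m = 3 * M * k + (M + d)"
    "x \<in> core (Suc n) (3 * M * k + (M + d))"
    "real k + 1/3 + (real d + 1/3) / (3 * real M) \<le> x * (3 * real M) ^ n"
    "x * (3 * real M) ^ n \<le> real k + 1/3 + (real d + 2/3) / (3 * real M)"
proof -
  have p': "p \<in> cells (Suc n + m)" using p M by simp
  then have "p div (3 * M) ^ m \<in> cells (Suc n)" using cells_div_mod by blast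
  then obtain k d where kd: "k \<in> cells n" "d < M" "p div (3 * M) ^ m = 3 * M * k + (M + d)"
    by auto
  have "x \<in> core (Suc n) (3 * M * k + (M + d))"
    using core_ancestor[OF p'] x M kd(3) by auto
  then show ?thesis using that[OF kd] core_child[OF kd(2)] by blast
qed

section \<open>Most points have a large digit sum\<close>

text \<open>Independence of the digits: the exponential moment of the digit sum is a product.\<close>

lemma sum_exp_digit_sum:
  "(\<Sum>p\<in>cells n. exp (- digit_sum n p)) = (\<Sum>d<M. exp (- 1 / (real d + 1))) ^ n"
proof (induction n)
  case 0 show ?case by (simp add: digit_sum_def)
next
  case (Suc n)
  have step: "digit_sum (Suc n) (3 * M * k + (M + d)) = 1 / (real d + 1) + digit_sum n k"
    if "d < M" for k d
  proof -
    have "(3 * M * k + (M + d)) div (3 * M) ^ Suc j = k div (3 * M) ^ j" for j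
      using append_digit(1)[OF that, of k] by (simp only: power_Suc div_mult2_eq)
    then show ?thesis
      unfolding digit_sum_def sum.lessThan_Suc_shift
      using append_digit(2)[OF that, of k] by (simp del: power_Suc)
  qed
  have "(\<Sum>p\<in>cells (Suc n). exp (- digit_sum (Suc n) p))
      = (\<Sum>(k, d)\<in>cells n \<times> {..<M}. exp (- digit_sum (Suc n) (3 * M * k + (M + d))))"
    using sum.reindex[OF inj_append_digit, of "\<lambda>p. exp (- digit_sum (Suc n) p)"]
    by (simp add: case_prod_unfold o_def)
  also have "\<dots> = (\<Sum>(k, d)\<in>cells n \<times> {..<M}. exp (- digit_sum n k) * exp (- 1 / (real d + 1)))"
    by (intro sum.cong) (auto simp: step exp_add[symmetric])
  also have "\<dots> = (\<Sum>d<M. exp (- 1 / (real d + 1))) ^ Suc n"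
    by (simp add: sum.cartesian_product[symmetric] sum_product[symmetric] Suc)
  finally show ?case .
qed

text \<open>Chernoff's bound with exponent \<open>1\<close>. Since \<open>\<Sum> 1/m^2 \<le> 2\<close>, one digit has exponential moment at most
\<open>1 - (harm M - 1) / M\<close>, so \<open>M\<close> digits have at most \<open>exp (1 - harm M)\<close>; Markov's inequality costs
a factor \<open>exp (harm M - 2)\<close>.\<close>

lemma card_small_digit_sum:
  "real (card {p \<in> cells M. digit_sum M p \<le> harm M - 2}) \<le> real M ^ M * exp (- 1)"
proof -
  let ?B = "{p \<in> cells M. digit_sum M p \<le> harm M - 2}"
  have P: "real M > 0" using M_pos by simp
  have h: "(\<Sum>d<M. 1 / (real d + 1)) = harm M"
    unfolding harm_def by (rule sum.reindex_bij_witness[of _ "\<lambda>k. k - 1" Suc]) (auto simp: field_simps)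
  have s: "(\<Sum>d<M. (1 / (real d + 1))\<^sup>2) = (\<Sum>m\<in>{1..M}. 1 / (real m)\<^sup>2)"
    by (rule sum.reindex_bij_witness[of _ "\<lambda>k. k - 1" Suc]) (auto simp: field_simps)
  have "(\<Sum>d<M. exp (- 1 / (real d + 1))) \<le> (\<Sum>d<M. 1 - 1 / (real d + 1) + (1 / (real d + 1))\<^sup>2 / 2)"
    by (intro sum_mono) (use exp_minus_le in force)
  also have "\<dots> = M - harm M + (\<Sum>d<M. (1 / (real d + 1))\<^sup>2) / 2"
    by (simp add: sum.distrib sum_subtractf h sum_divide_distrib)
  also have "\<dots> \<le> M - harm M + 1"
    using sum_inverse_squares_le[of M] s by simp
  also have "\<dots> = M * (1 + (1 - harm M) / M)" using P by (simp add: field_simps)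
  also have "\<dots> \<le> M * exp ((1 - harm M) / M)"
    using P by (intro mult_left_mono exp_ge_add_one_self) auto
  finally have "(\<Sum>d<M. exp (- 1 / (real d + 1))) ^ M \<le> (M * exp ((1 - harm M) / M)) ^ M"
    by (intro power_mono sum_nonneg) auto
  also have "\<dots> = M ^ M * exp (1 - harm M)"
    using P by (simp add: power_mult_distrib exp_of_nat_mult[symmetric])
  finally have up: "(\<Sum>p\<in>cells M. exp (- digit_sum M p)) \<le> M ^ M * exp (1 - harm M)"
    by (simp add: sum_exp_digit_sum)
  have "card ?B * exp (2 - harm M) = (\<Sum>p\<in>?B. exp (2 - harm M))" by simp
  also have "\<dots> \<le> (\<Sum>p\<in>?B. exp (- digit_sum M p))" by (intro sum_mono) auto
  also have "\<dots> \<le> (\<Sum>p\<in>cells M. exp (- digit_sum M p))" by (intro sum_mono2) auto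
  finally have "card ?B * exp (2 - harm M) \<le> M ^ M * exp (1 - harm M)" using up by linarith
  also have "exp (1 - harm M) = exp (- 1) * exp (2 - harm M :: real)"
    by (simp add: exp_add[symmetric])
  finally show ?thesis by simp
qed

lemma card_large_digit_sum:
  "real (card {p \<in> cells M. digit_sum M p > ln M - 2}) \<ge> real M ^ M / 2"
proof -
  let ?B = "{p \<in> cells M. digit_sum M p \<le> harm M - 2}"
  let ?G = "{p \<in> cells M. digit_sum M p > ln M - 2}"
  have "ln (real M) \<le> ln (real M + 1)" using M_pos by simp
  also have "\<dots> \<le> harm M" by (rule ln_le_harm)
  finally have "cells M \<subseteq> ?G \<union> ?B" by auto
  then have "card (cells M) \<le> card (?G \<union> ?B)" by (intro card_mono) auto
  also have "\<dots> \<le> card ?G + card ?B" by (rule card_Un_le)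
  finally have "real (M ^ M) \<le> real (card ?G + card ?B)"
    unfolding card_cells by (rule of_nat_mono)
  moreover have "real M ^ M * exp (- 1) \<le> real M ^ M * (1/2)"
    using exp_ge_add_one_self[of 1] by (intro mult_left_mono) (auto simp: exp_minus field_simps)
  ultimately show ?thesis using card_small_digit_sum by simp
qed

section \<open>The maximal function on the dipoles\<close>

lemma flank_support_dist:
  assumes i: "i < M" and x: "x \<in> support" and z: "z \<in> left_flank i k \<union> right_flank i k"
  shows "1 / (3 * (3 * real M) ^ Suc i) \<le> \<bar>x - z\<bar>"
proof -
  have P: "real M \<ge> 1" using M_pos by simp
  let ?s = "(3 * real M) ^ i"
  have s: "?s > 0" using P by simp
  from x obtain p where p: "p \<in> cells M" "x \<in> core M p" by (auto simp: support_def)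
  obtain m where m: "M = i + Suc m" using less_imp_Suc_add[OF i] by auto
  obtain k0 d where kd: "d < M"
    "real k0 + 1/3 + (real d + 1/3) / (3 * real M) \<le> x * ?s"
    "x * ?s \<le> real k0 + 1/3 + (real d + 2/3) / (3 * real M)"
    by (rule core_locate_child[OF p m], rule that)
  have d: "real d + 1 \<le> real M" using kd(1) by linarith
  define e where "e = 1 / (9 * real M)"
  have e: "e > 0" "e \<le> 1/9" using P by (auto simp: e_def field_simps)
  have lo: "(real d + 1/3) / (3 * real M) \<ge> e" using P by (auto simp: e_def field_simps)
  have "(real d + 2/3) / (3 * real M) \<le> (real M - 1/3) / (3 * real M)"
    using P d by (intro divide_right_mono) auto
  also have "\<dots> = 1/3 - e" using P by (simp add: e_def diff_divide_distrib)
  finally have hi: "(real d + 2/3) / (3 * real M) \<le> 1/3 - e" .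
  have z': "real k + 1/3 - e \<le> z * ?s \<and> z * ?s \<le> real k + 1/3 \<or>
            real k + 2/3 \<le> z * ?s \<and> z * ?s \<le> real k + 2/3 + e"
    using z s by (auto simp: left_flank_def right_flank_def e_def pos_divide_le_eq pos_le_divide_eq)
  have "e \<le> \<bar>x * ?s - z * ?s\<bar>"
  proof (cases "k = k0")
    case True
    then show ?thesis using z' kd lo hi e by linarith
  next
    case False
    then have "real k \<ge> real k0 + 1 \<or> real k + 1 \<le> real k0" by linarith
    then show ?thesis using z' kd lo hi e by linarith
  qed
  also have "\<dots> = \<bar>x - z\<bar> * ?s"
    using s by (simp add: left_diff_distrib[symmetric] abs_mult)
  finally have "e / ?s \<le> \<bar>x - z\<bar>" using s by (simp add: pos_divide_le_eq)
  moreover have "e / ?s = 1 / (3 * (3 * real M) ^ Suc i)" by (simp add: e_def)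
  ultimately show ?thesis by simp
qed

text \<open>The length of the interval bounds the distance between its points in the first and in the last core
that it meets, and with it the number of cells in between.\<close>

lemma card_cells_meeting_interval:
  assumes "is_interval I" "bounded I"
  shows "real (card {k \<in> cells n. I \<inter> core n k \<noteq> {}}) \<le> measure lebesgue I * (3 * real M) ^ n + 2"
proof -
  let ?W = "{k \<in> cells n. I \<inter> core n k \<noteq> {}}"
  let ?s = "(3 * real M) ^ n"
  have s: "?s > 0" using M_pos by simp
  show ?thesis
  proof (cases "?W = {}")
    case True
    then show ?thesis using s by (simp only: card.empty) simp
  next
    case False
    have fin: "finite ?W" by simp
    define k1 where "k1 = Min ?W"
    define k2 where "k2 = Max ?W"
    have k1: "k1 \<in> ?W" and k2: "k2 \<in> ?W"
      unfolding k1_def k2_def using Min_in[OF fin False] Max_in[OF fin False] by auto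
    have le: "k1 \<le> k2" unfolding k1_def using Min_le[OF fin k2] .
    have "?W \<subseteq> {k1..k2}" unfolding k1_def k2_def using Min_le[OF fin] Max_ge[OF fin] by fastforce
    then have "card ?W \<le> card {k1..k2}" by (intro card_mono) auto
    then have c: "real (card ?W) \<le> real k2 - real k1 + 1" using le by simp
    from k1 obtain x1 where x1: "x1 \<in> I" "x1 \<in> core n k1" by auto
    from k2 obtain x2 where x2: "x2 \<in> I" "x2 \<in> core n k2" by auto
    have "(x2 - x1) * ?s \<le> measure lebesgue I * ?s"
      using diff_le_measure_interval[OF assms x1(1) x2(1)] s by (intro mult_right_mono) auto
    moreover have "(x2 - x1) * ?s \<ge> real k2 - real k1 - 1/3"
      using x1(2) x2(2) by (simp add: mem_core_iff left_diff_distrib)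
    ultimately show ?thesis using c by linarith
  qed
qed

lemma core_measurable [measurable]: "core n k \<in> sets borel"
  by (simp add: core_def)

lemma core_lmeasurable: "core n k \<in> lmeasurable"
  by (simp add: core_def)

lemma support_measurable [measurable]: "support \<in> sets borel"
  unfolding support_def by (intro sets.finite_UN core_measurable finite_cells)

lemma measure_core: "measure lebesgue (core n k) = 1 / (3 * (3 * real M) ^ n)"
proof -
  have "(real k + 1/3) / (3 * real M) ^ n \<le> (real k + 2/3) / (3 * real M) ^ n"
    by (intro divide_right_mono) auto
  then show ?thesis
    by (simp add: core_def diff_divide_distrib[symmetric])
qed

text \<open>Each cell of level \<open>n\<close> carries the same amount of the support, so it suffices to count the cells that the
interval meets. For intervals that are not short compared with the cells of level \<open>n\<close> this bounds
the average of the weight by a multiple of \<open>3^n\<close>.\<close>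

lemma measure_interval_support_le:
  assumes I: "is_interval I" "bounded I" and n: "M = n + m"
  shows "measure lebesgue (I \<inter> support)
     \<le> (measure lebesgue I + 2 / (3 * real M) ^ n) * 3 ^ n / 3 ^ Suc M"
proof -
  let ?W = "{k \<in> cells n. I \<inter> core n k \<noteq> {}}"
  let ?Q = "\<Union>k\<in>?W. {p \<in> cells M. p div (3 * M) ^ m = k}"
  have P: "real M > 0" using M_pos by simp
  have Imeas: "I \<in> sets lebesgue" using interval_lmeasurable[OF I] by auto
  have sub: "I \<inter> support \<subseteq> (\<Union>p\<in>?Q. core M p)"
  proof
    fix x assume "x \<in> I \<inter> support"
    then obtain p where p: "x \<in> I" "p \<in> cells M" "x \<in> core M p"
      by (auto simp: support_def)
    then have "p div (3 * M) ^ m \<in> ?W"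
      using core_ancestor[where n = n and m = m, folded n, OF p(2)]
        cells_div_mod[where n = n and m = m, folded n, OF p(2)] by auto
    then show "x \<in> (\<Union>p\<in>?Q. core M p)" using p by auto
  qed
  have "card ?Q \<le> (\<Sum>k\<in>?W. card {p \<in> cells M. p div (3 * M) ^ m = k})"
    by (intro card_UN_le) simp
  also have "\<dots> \<le> (\<Sum>k\<in>?W. M ^ m)"
    by (intro sum_mono card_descendants[where n = n and m = m, folded n])
  finally have "card ?Q \<le> card ?W * M ^ m" by simp
  then have "real (card ?Q) \<le> real (card ?W * M ^ m)" by (rule of_nat_mono)
  also have "\<dots> = real (card ?W) * real M ^ m" by simp
  also have "\<dots> \<le> (measure lebesgue I * (3 * real M) ^ n + 2) * real M ^ m"
    using card_cells_meeting_interval[OF I] by (intro mult_right_mono) auto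
  finally have Q: "real (card ?Q) \<le> (measure lebesgue I * (3 * real M) ^ n + 2) * real M ^ m" .
  have finQ: "finite ?Q" by auto
  have "measure lebesgue (I \<inter> support) \<le> measure lebesgue (\<Union>p\<in>?Q. core M p)"
    using sub finQ Imeas core_lmeasurable by (intro measure_mono_fmeasurable) (auto intro!: fmeasurable.finite_UN)
  also have "\<dots> \<le> (\<Sum>p\<in>?Q. measure lebesgue (core M p))"
    using finQ core_lmeasurable by (intro measure_UNION_le) auto
  also have "\<dots> = real (card ?Q) / (3 * (3 * real M) ^ M)" by (simp add: measure_core)
  also have "\<dots> \<le> (measure lebesgue I * (3 * real M) ^ n + 2) * real M ^ m / (3 * (3 * real M) ^ M)"
    using Q P by (intro divide_right_mono) auto
  also have "\<dots> = (measure lebesgue I + 2 / (3 * real M) ^ n) * 3 ^ n / 3 ^ Suc M"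
  proof -
    have "(3 * real M) ^ M = (3 * real M) ^ n * (3 ^ m * real M ^ m)"
      using n by (metis power_add power_mult_distrib)
    moreover have "(3::real) ^ Suc M = 3 * (3 ^ n * 3 ^ m)"
      using n by (metis power_add power_Suc)
    ultimately show ?thesis using P by (simp add: divide_simps)
  qed
  finally show ?thesis .
qed

text \<open>An interval through a flank of level \<open>i\<close> that meets the support has at least a third of the length
of a cell of level \<open>i + 1\<close>, by \<open>flank_support_dist\<close>; counting cells of that level bounds its average of
the weight by \<open>21 * 3^i\<close>. As the weight takes only the values \<open>0\<close> and \<open>T = 3^(M+1)\<close>,
the Luxemburg norm follows from \<open>\<Phi> (T / l) \<le> \<Phi> T / l\<close>, which is convexity together with \<open>\<Phi> 0 = 0\<close>.\<close>

lemma orlicz_maximal_flank: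
  assumes Y: "young_function \<Phi>" and A: "1 \<le> A" "21 * \<Phi> (3 ^ Suc M) / 3 ^ Suc M \<le> A"
    and i: "i < M" and z: "z \<in> left_flank i k \<union> right_flank i k"
  shows "orlicz_maximal \<Phi> cantor_weight z \<le> ennreal (A * 3 ^ i)"
  unfolding orlicz_maximal_def
proof (rule SUP_least)
  fix I :: "real set"
  assume "I \<in> {I. is_interval I \<and> bounded I \<and> 0 < emeasure lebesgue I \<and> z \<in> I}"
  then have I: "is_interval I" "bounded I" "0 < emeasure lebesgue I" "z \<in> I" by simp_all
  let ?T = "3 ^ Suc M :: real"
  let ?l = "A * 3 ^ i"
  have l: "1 \<le> ?l" using mult_mono[OF A(1) one_le_power[of "3::real" i]] A(1) by simp
  have Imeas: "I \<in> lmeasurable"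
    using I by (intro interval_lmeasurable)
  have conv: "convex_on {0..} \<Phi>" and nn: "\<And>t. 0 \<le> t \<Longrightarrow> 0 \<le> \<Phi> t" and z0: "\<Phi> 0 = 0"
    using Y by (auto simp: young_function_def)
  have "\<Phi> ((1 - 1 / ?l) *\<^sub>R 0 + (1 / ?l) *\<^sub>R ?T) \<le> (1 - 1 / ?l) * \<Phi> 0 + (1 / ?l) * \<Phi> ?T"
    using l by (intro convex_onD[OF conv]) auto
  then have phi: "\<Phi> (?T / ?l) \<le> \<Phi> ?T / ?l" using z0 by simp
  have frac: "\<Phi> ?T / ?l * (measure lebesgue (I \<inter> support)) \<le> measure lebesgue I"
  proof (cases "I \<inter> support = {}")
    case True
    then show ?thesis by simp
  next
    case False
    then obtain x where x: "x \<in> I" "x \<in> support" by auto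
    obtain m where m: "M = Suc i + m" using less_imp_Suc_add[OF i] by auto
    have "1 / (3 * (3 * real M) ^ Suc i) \<le> \<bar>x - z\<bar>" by (rule flank_support_dist[OF i x(2) z])
    also have "\<dots> \<le> measure lebesgue I"
      using diff_le_measure_interval[OF I(1,2)] x(1) I(4) by (auto simp: abs_le_iff)
    finally have "1 / (3 * (3 * real M) ^ Suc i) \<le> measure lebesgue I" .
    moreover have "2 / (3 * real M) ^ Suc i = 6 * (1 / (3 * (3 * real M) ^ Suc i))" by simp
    ultimately have "2 / (3 * real M) ^ Suc i \<le> 6 * measure lebesgue I" by linarith
    then have "(measure lebesgue I + 2 / (3 * real M) ^ Suc i) * 3 ^ Suc i / ?T
        \<le> (7 * measure lebesgue I) * 3 ^ Suc i / ?T"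
      by (intro divide_right_mono mult_right_mono) auto
    with measure_interval_support_le[OF I(1,2) m]
    have "measure lebesgue (I \<inter> support) \<le> (7 * measure lebesgue I) * 3 ^ Suc i / ?T"
      by (rule order_trans)
    also have "\<dots> = 21 * 3 ^ i / ?T * measure lebesgue I" by simp
    finally have "\<Phi> ?T / ?l * measure lebesgue (I \<inter> support) \<le> \<Phi> ?T / ?l * (21 * 3 ^ i / ?T * measure lebesgue I)"
      using nn[of ?T] l by (intro mult_left_mono) auto
    also have "\<dots> = (21 * \<Phi> ?T / ?T) / A * measure lebesgue I" by (simp add: mult_ac)
    also have "\<dots> \<le> 1 * measure lebesgue I"
      using A by (intro mult_right_mono iffD2[OF divide_le_eq_1_pos]) simp_all
    finally show ?thesis by simp
  qed
  have "(\<integral>\<^sup>+y\<in>I. ennreal (\<Phi> (\<bar>cantor_weight y\<bar> / ?l)) \<partial>lebesgue)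
      = (\<integral>\<^sup>+y. ennreal (\<Phi> (?T / ?l)) * indicator (I \<inter> support) y \<partial>lebesgue)"
    by (intro nn_integral_cong) (auto simp: cantor_weight_def z0 split: split_indicator)
  also have "\<dots> = ennreal (\<Phi> (?T / ?l)) * emeasure lebesgue (I \<inter> support)"
    using Imeas by (intro nn_integral_cmult_indicator) auto
  also have "\<dots> = ennreal (\<Phi> (?T / ?l) * measure lebesgue (I \<inter> support))"
    using Imeas nn[of "?T / ?l"] l
    by (simp add: emeasure_eq_measure2 fmeasurable_Int_fmeasurable ennreal_mult)
  also have "\<dots> \<le> ennreal (measure lebesgue I)"
    using mult_right_mono[OF phi, of "measure lebesgue (I \<inter> support)"] frac
    by (intro ennreal_leI) simp
  also have "\<dots> = emeasure lebesgue I" using Imeas by (simp add: emeasure_eq_measure2)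
  finally have "(\<integral>\<^sup>+y\<in>I. ennreal (\<Phi> (\<bar>cantor_weight y\<bar> / ?l)) \<partial>lebesgue) / emeasure lebesgue I \<le> 1"
    using I(3) by (intro divide_le_posI_ennreal) auto
  then show "luxemburg_norm \<Phi> I cantor_weight \<le> ennreal ?l"
    unfolding luxemburg_norm_def using l by (intro Inf_lower) auto
qed

lemma emeasure_flanks:
  "emeasure lebesgue (left_flank n k) = ennreal (1 / (9 * real M * (3 * real M) ^ n))"
  "emeasure lebesgue (right_flank n k) = ennreal (1 / (9 * real M * (3 * real M) ^ n))"
proof -
  have "(real k + 1/3 - 1 / (9 * real M)) / (3 * real M) ^ n \<le> (real k + 1/3) / (3 * real M) ^ n"
    "(real k + 2/3) / (3 * real M) ^ n \<le> (real k + 2/3 + 1 / (9 * real M)) / (3 * real M) ^ n"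
    by (intro divide_right_mono; simp)+
  then show "emeasure lebesgue (left_flank n k) = ennreal (1 / (9 * real M * (3 * real M) ^ n))"
    "emeasure lebesgue (right_flank n k) = ennreal (1 / (9 * real M * (3 * real M) ^ n))"
    by (simp_all add: left_flank_def right_flank_def diff_divide_distrib[symmetric])
qed

lemma flanks_measurable [measurable]:
  "left_flank n k \<in> sets borel" "right_flank n k \<in> sets borel"
  by (simp_all add: left_flank_def right_flank_def)

text \<open>Level \<open>n\<close> has \<open>M^n\<close> cells with two flanks of length \<open>1 / (9M (3M)^n)\<close> each, on which the maximal
function is at most \<open>A 3^n\<close>: every one of the \<open>M\<close> levels contributes \<open>2A / (9M)\<close>.\<close>

lemma dipoles_norm_le:
  assumes Y: "young_function \<Phi>" and A: "1 \<le> A" "21 * \<Phi> (3 ^ Suc M) / 3 ^ Suc M \<le> A"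
  shows "(\<integral>\<^sup>+x. ennreal \<bar>dipoles x\<bar> * orlicz_maximal \<Phi> cantor_weight x \<partial>lebesgue) \<le> ennreal (2 * A / 9)"
proof -
  let ?W = "orlicz_maximal \<Phi> cantor_weight"
  let ?L = "\<lambda>n k x. indicator (left_flank n k) x :: ennreal"
  let ?R = "\<lambda>n k x. indicator (right_flank n k) x :: ennreal"
  have P: "real M > 0" using M_pos by simp
  have sets: "left_flank n k \<in> sets lebesgue" "right_flank n k \<in> sets lebesgue" for n k
    by (simp_all add: left_flank_def right_flank_def)
  have pt: "ennreal \<bar>dipoles x\<bar> * ?W x
      \<le> (\<Sum>n<M. \<Sum>k\<in>cells n. ennreal (A * 3 ^ n) * (?L n k x + ?R n k x))" for x
  proof -
    have "\<bar>dipoles x\<bar> \<le> (\<Sum>n<M. \<bar>\<Sum>k\<in>cells n. indicator (left_flank n k) x - indicator (right_flank n k) x\<bar>)"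
      unfolding dipoles_def by (rule sum_abs)
    also have "\<dots> \<le> (\<Sum>n<M. \<Sum>k\<in>cells n. \<bar>indicator (left_flank n k) x - indicator (right_flank n k) x\<bar>)"
      by (intro sum_mono sum_abs)
    also have "\<dots> \<le> (\<Sum>n<M. \<Sum>k\<in>cells n. indicator (left_flank n k) x + indicator (right_flank n k) x)"
      by (intro sum_mono) (auto split: split_indicator)
    finally have "ennreal \<bar>dipoles x\<bar>
        \<le> ennreal (\<Sum>n<M. \<Sum>k\<in>cells n. indicator (left_flank n k) x + indicator (right_flank n k) x)"
      by (rule ennreal_leI)
    also have "\<dots> = (\<Sum>n<M. \<Sum>k\<in>cells n. ?L n k x + ?R n k x)"
      by (simp add: sum_ennreal[symmetric] sum_nonneg ennreal_indicator)
    finally have "ennreal \<bar>dipoles x\<bar> * ?W x \<le> (\<Sum>n<M. \<Sum>k\<in>cells n. ?L n k x + ?R n k x) * ?W x"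
      by (rule mult_right_mono) simp
    also have "\<dots> = (\<Sum>n<M. \<Sum>k\<in>cells n. (?L n k x + ?R n k x) * ?W x)"
      by (simp add: sum_distrib_right)
    also have "\<dots> \<le> (\<Sum>n<M. \<Sum>k\<in>cells n. ennreal (A * 3 ^ n) * (?L n k x + ?R n k x))"
    proof (intro sum_mono)
      fix n k assume "n \<in> {..<M}"
      then have n: "n < M" by simp
      show "(?L n k x + ?R n k x) * ?W x \<le> ennreal (A * 3 ^ n) * (?L n k x + ?R n k x)"
      proof (cases "x \<in> left_flank n k \<union> right_flank n k")
        case True
        then show ?thesis
          using orlicz_maximal_flank[OF Y A n True]
          by (subst mult.commute) (intro mult_right_mono, auto)
      next
        case False
        then show ?thesis by simp
      qed
    qed
    finally show ?thesis .
  qed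
  have "(\<integral>\<^sup>+x. ennreal \<bar>dipoles x\<bar> * ?W x \<partial>lebesgue)
      \<le> (\<integral>\<^sup>+x. (\<Sum>n<M. \<Sum>k\<in>cells n. ennreal (A * 3 ^ n) * (?L n k x + ?R n k x)) \<partial>lebesgue)"
    by (intro nn_integral_mono pt)
  also have "\<dots> = (\<Sum>n<M. \<Sum>k\<in>cells n. ennreal (A * 3 ^ n) *
      (emeasure lebesgue (left_flank n k) + emeasure lebesgue (right_flank n k)))"
  proof -
    have meas: "(\<lambda>x. ?L n k x + ?R n k x) \<in> borel_measurable lebesgue" for n k
      by (intro borel_measurable_add borel_measurable_indicator sets)
    have single: "(\<integral>\<^sup>+x. ennreal (A * 3 ^ n) * (?L n k x + ?R n k x) \<partial>lebesgue)
        = ennreal (A * 3 ^ n) * (emeasure lebesgue (left_flank n k) + emeasure lebesgue (right_flank n k))" for n k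
      using sets[of n k] by (simp only: nn_integral_cmult[OF meas]
          nn_integral_add borel_measurable_indicator nn_integral_indicator)
    have meas': "(\<lambda>x. ennreal (A * 3 ^ n) * (?L n k x + ?R n k x)) \<in> borel_measurable lebesgue" for n k
      using meas[of n k] by (intro borel_measurable_times_ennreal) auto
    show ?thesis
      by (subst nn_integral_sum) (intro borel_measurable_sum meas' sum.cong refl | simp only: nn_integral_sum[OF meas'] single)+
  qed
  also have "\<dots> = (\<Sum>n<M. \<Sum>k\<in>cells n. ennreal (A * 3 ^ n * (2 / (9 * real M * (3 * real M) ^ n))))"
    using A(1) by (simp add: emeasure_flanks ennreal_plus[symmetric] ennreal_mult[symmetric] del: ennreal_plus)
  also have "\<dots> = ennreal (\<Sum>n<M. \<Sum>k\<in>cells n. A * 3 ^ n * (2 / (9 * real M * (3 * real M) ^ n)))"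
  proof -
    have "0 \<le> A * 3 ^ n * (2 / (9 * real M * (3 * real M) ^ n))" for n using A(1) by simp
    then show ?thesis by (simp only: sum_ennreal sum_nonneg)
  qed
  also have "(\<Sum>n<M. \<Sum>k\<in>cells n. A * 3 ^ n * (2 / (9 * real M * (3 * real M) ^ n)))
      = (\<Sum>n<M. 2 * A / (9 * real M))"
    using P by (intro sum.cong) (simp_all add: card_cells power_mult_distrib)
  also have "\<dots> = 2 * A / 9" using P by simp
  finally show ?thesis .
qed

section \<open>The Hilbert transform on the support\<close>

abbreviation dipole_potential :: "nat \<Rightarrow> nat \<Rightarrow> real \<Rightarrow> real" where
  "dipole_potential n k x \<equiv>
     (LINT y:left_flank n k|lebesgue. 1 / (x - y)) - (LINT y:right_flank n k|lebesgue. 1 / (x - y))"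

lemma support_not_in_flank:
  assumes "x \<in> support" "n < M"
  shows "x \<notin> left_flank n k" "x \<notin> right_flank n k"
proof -
  have "0 < 1 / (3 * (3 * real M) ^ Suc n)" using M_pos by simp
  then show "x \<notin> left_flank n k" "x \<notin> right_flank n k"
    using flank_support_dist[OF assms(2,1), of x k] by auto
qed

lemma hilbert_transform_dipoles:
  assumes "x \<in> support"
  shows "hilbert_transform dipoles x = 1 / pi * (\<Sum>n<M. \<Sum>k\<in>cells n. dipole_potential n k x)"
proof -
  have "has_hilbert_transform (\<lambda>y. indicator (left_flank n k) y - indicator (right_flank n k) y) x
      (1 / pi * (LINT y:left_flank n k|lebesgue. 1 / (x - y))
       - 1 / pi * (LINT y:right_flank n k|lebesgue. 1 / (x - y)))" if "n < M" for n k
    using support_not_in_flank[OF assms that, of k] unfolding left_flank_def right_flank_def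
    by (intro has_hilbert_transform_diff has_hilbert_transform_indicator)
  then have "has_hilbert_transform dipoles x (\<Sum>n<M. \<Sum>k\<in>cells n.
      1 / pi * (LINT y:left_flank n k|lebesgue. 1 / (x - y))
       - 1 / pi * (LINT y:right_flank n k|lebesgue. 1 / (x - y)))"
    unfolding dipoles_def[abs_def] by (intro has_hilbert_transform_sum) auto
  then show ?thesis
    by (simp add: hilbert_transform_eq sum_distrib_left right_diff_distrib)
qed

text \<open>Bounding the kernel on the left flank by its value at the left end, and on the right flank by its value
at the right end, replaces the dipole by two point masses of size \<open>e\<close> at the outer ends of the flanks,
in units of the cell.\<close>

lemma dipole_potential_ge:
  fixes x :: real and n k :: nat
  defines "u \<equiv> x * (3 * real M) ^ n - real k" and "e \<equiv> 1 / (9 * real M)"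
  assumes x: "x \<in> support" "n < M"
  shows "e * (1 / (u - 1/3 + e) - 1 / (u - 2/3 - e)) \<le> dipole_potential n k x"
proof -
  let ?s = "(3 * real M) ^ n"
  have P: "real M > 0" using M_pos by simp
  then have s: "?s > 0" by simp
  have e: "e > 0" using P by (simp add: e_def)
  have scale: "(b / ?s - a / ?s) / (x - d / ?s) = (b - a) / (x * ?s - d)" for a b d
  proof -
    have "(b / ?s - a / ?s) / (x - d / ?s) = ((b / ?s - a / ?s) * ?s) / ((x - d / ?s) * ?s)"
      using s by simp
    also have "\<dots> = (b - a) / (x * ?s - d)" using P by (simp add: left_diff_distrib)
    finally show ?thesis .
  qed
  have "(real k + 1/3 - e) / ?s \<le> (real k + 1/3) / ?s"
    using s e by (intro divide_right_mono) auto
  from cauchy_kernel_integral_bounds(1)[OF _ this, of x]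
  have "e / (u - 1/3 + e) \<le> (LINT y:left_flank n k|lebesgue. 1 / (x - y))"
    using support_not_in_flank(1)[OF x, of k]
    unfolding left_flank_def e_def[symmetric] scale by (simp add: u_def algebra_simps)
  moreover have "(real k + 2/3) / ?s \<le> (real k + 2/3 + e) / ?s"
    using s e by (intro divide_right_mono) auto
  from cauchy_kernel_integral_bounds(2)[OF _ this, of x]
  have "(LINT y:right_flank n k|lebesgue. 1 / (x - y)) \<le> e / (u - 2/3 - e)"
    using support_not_in_flank(2)[OF x, of k]
    unfolding right_flank_def e_def[symmetric] scale by (simp add: u_def algebra_simps)
  ultimately show ?thesis by (simp add: right_diff_distrib)
qed

text \<open>In its own cell the point lies between the two poles of the dipole, so both contribute positively, and
the distance to the left one is at most \<open>(d + 1) / (3M)\<close> cell lengths. The remaining cells are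
controlled by \<open>far_dipole_bound\<close>.\<close>

lemma level_potential_ge:
  assumes p: "p \<in> cells M" and x: "x \<in> core M p" and m: "M = n + Suc m"
  shows "1 / (3 * (real (p div (3 * M) ^ m mod (3 * M)) - M + 1)) - 4 / (9 * real M)
     \<le> (\<Sum>k\<in>cells n. dipole_potential n k x)"
proof -
  define e where "e = 1 / (9 * real M)"
  have P: "real M \<ge> 1" using M_pos by simp
  have e: "0 < e" "e \<le> 1/9" using P by (auto simp: e_def field_simps)
  have n: "n < M" using m by simp
  have xs: "x \<in> support" using p x by (auto simp: support_def)
  obtain k0 d where kd: "k0 \<in> cells n" "d < M" "p div (3 * M) ^ m = 3 * M * k0 + (M + d)"
    and xc: "x \<in> core (Suc n) (3 * M * k0 + (M + d))"
    and hi: "x * (3 * real M) ^ n \<le> real k0 + 1/3 + (real d + 2/3) / (3 * real M)"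
    by (rule core_locate_child[OF p x m])
  have x0: "x \<in> core n k0"
    using core_child_subset[OF kd(2)] xc by blast
  define v where "v = x * (3 * real M) ^ n - real k0"
  have v: "1/3 \<le> v" "v \<le> 2/3" using x0 by (auto simp: mem_core_iff v_def)
  have digit: "p div (3 * M) ^ m mod (3 * M) = M + d"
    using append_digit(2)[OF kd(2), of k0] kd(3) by simp
  have "1 / (3 * (real d + 1)) \<le> dipole_potential n k0 x"
  proof -
    have "v - 1/3 + e \<le> (real d + 2/3) / (3 * real M) + e" using hi by (simp add: v_def)
    also have "\<dots> = (real d + 1) / (3 * real M)" using P by (simp add: e_def divide_simps)
    finally have "v - 1/3 + e \<le> (real d + 1) / (3 * real M)" .
    then have "e / ((real d + 1) / (3 * real M)) \<le> e / (v - 1/3 + e)"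
      using e v P by (intro divide_left_mono) auto
    moreover have "e / ((real d + 1) / (3 * real M)) = 1 / (3 * (real d + 1))"
      using P by (simp add: e_def)
    moreover have "e / (v - 2/3 - e) \<le> 0" using e v by (intro divide_nonneg_neg) auto
    moreover have "e * (1 / (v - 1/3 + e) - 1 / (v - 2/3 - e)) \<le> dipole_potential n k0 x"
      using dipole_potential_ge[OF xs n, of k0] by (simp only: v_def e_def)
    moreover have "e * (1 / (v - 1/3 + e) - 1 / (v - 2/3 - e)) = e / (v - 1/3 + e) - e / (v - 2/3 - e)"
      by (simp add: right_diff_distrib)
    ultimately show ?thesis by linarith
  qed
  moreover have "- (4 * e) \<le> (\<Sum>k\<in>cells n - {k0}. dipole_potential n k x)"
  proof -
    have "e * (- (1 / (real k - real k0)\<^sup>2)) \<le> dipole_potential n k x" if "k \<in> cells n - {k0}" for k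
    proof -
      have "- (1 / (real_of_int (int k - int k0))\<^sup>2)
          \<le> 1 / (v - real_of_int (int k - int k0) - 1/3 + e) - 1 / (v - real_of_int (int k - int k0) - 2/3 - e)"
        using that v e by (intro far_dipole_bound) auto
      then have "e * (- (1 / (real k - real k0)\<^sup>2))
          \<le> e * (1 / (v - (real k - real k0) - 1/3 + e) - 1 / (v - (real k - real k0) - 2/3 - e))"
        using e by (intro mult_left_mono) auto
      also have "v - (real k - real k0) = x * (3 * real M) ^ n - real k" by (simp add: v_def)
      also have "e * (1 / (x * (3 * real M) ^ n - real k - 1/3 + e) - 1 / (x * (3 * real M) ^ n - real k - 2/3 - e))
          \<le> dipole_potential n k x"
        using dipole_potential_ge[OF xs n, of k] by (simp add: e_def)
      finally show ?thesis .
    qed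
    then have "(\<Sum>k\<in>cells n - {k0}. e * (- (1 / (real k - real k0)\<^sup>2)))
        \<le> (\<Sum>k\<in>cells n - {k0}. dipole_potential n k x)"
      by (intro sum_mono)
    moreover have "e * (\<Sum>k\<in>cells n - {k0}. 1 / (real k - real k0)\<^sup>2) \<le> e * 4"
      using e by (intro mult_left_mono sum_inverse_square_distances_le) auto
    moreover have "(\<Sum>k\<in>cells n - {k0}. e * (- (1 / (real k - real k0)\<^sup>2)))
        = - (e * (\<Sum>k\<in>cells n - {k0}. 1 / (real k - real k0)\<^sup>2))"
      by (simp add: sum_distrib_left sum_negf)
    ultimately show ?thesis by linarith
  qed
  moreover have "(\<Sum>k\<in>cells n. dipole_potential n k x)
      = dipole_potential n k0 x + (\<Sum>k\<in>cells n - {k0}. dipole_potential n k x)"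
    using kd(1) by (intro sum.remove) auto
  ultimately show ?thesis unfolding digit by (simp add: e_def)
qed

lemma hilbert_transform_dipoles_ge:
  assumes p: "p \<in> cells M" and x: "x \<in> core M p"
  shows "(digit_sum M p / 3 - 1) / pi \<le> hilbert_transform dipoles x"
proof -
  have P: "real M > 0" using M_pos by simp
  let ?g = "\<lambda>j. 1 / (3 * (real (p div (3 * M) ^ j mod (3 * M)) - M + 1)) - 4 / (9 * real M)"
  have xs: "x \<in> support" using p x by (auto simp: support_def)
  have "?g j = 1 / (real (p div (3 * M) ^ j mod (3 * M)) - M + 1) / 3 - 4 / (9 * real M)" for j
    by (simp only: divide_divide_eq_left mult.commute)
  then have "digit_sum M p / 3 - 4/9 = (\<Sum>j<M. ?g j)"
    using P by (simp only: digit_sum_def sum_subtractf sum_divide_distrib) simp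
  also have "\<dots> = (\<Sum>n<M. ?g (M - Suc n))" by (rule sum.nat_diff_reindex[symmetric])
  also have "\<dots> \<le> (\<Sum>n<M. \<Sum>k\<in>cells n. dipole_potential n k x)"
    by (intro sum_mono level_potential_ge p x) auto
  finally have "digit_sum M p / 3 - 1 \<le> (\<Sum>n<M. \<Sum>k\<in>cells n. dipole_potential n k x)" by simp
  then show ?thesis
    unfolding hilbert_transform_dipoles[OF xs] by (simp add: divide_right_mono)
qed

section \<open>Failure of the weak type inequality\<close>

lemma disjoint_cores: "disjoint_family_on (core n) S"
proof -
  have "core n p \<inter> core n q = {}" if "p < q" for p q
  proof -
    have "real p + 1 \<le> real q" using that by linarith
    then show ?thesis by (auto simp: mem_core_iff)
  qed
  then show ?thesis unfolding disjoint_family_on_def by (metis Int_commute linorder_neqE_nat)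
qed

text \<open>The threshold is the value of the lower bound \<open>(digit_sum M p / 3 - 1) / pi\<close> at a digit sum of \<open>ln M - 2\<close>.
Every core carries mass \<open>M^(-M)\<close>, and at least half of the \<open>M^M\<close> cores have a larger digit sum.\<close>

lemma weight_of_superlevel_ge:
  "ennreal (1/2) \<le> weight_of cantor_weight {x. (ln M - 5) / (3 * pi) < \<bar>hilbert_transform dipoles x\<bar>}"
    (is "_ \<le> weight_of _ ?H")
proof -
  let ?G = "{p \<in> cells M. digit_sum M p > ln M - 2}"
  let ?U = "\<Union>p\<in>?G. core M p"
  have P: "real M > 0" using M_pos by simp
  have sub: "?U \<subseteq> ?H \<inter> support"
  proof
    fix x assume "x \<in> ?U"
    then obtain p where p: "p \<in> cells M" "digit_sum M p > ln M - 2" "x \<in> core M p" by auto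
    have "(ln M - 5) / (3 * pi) < (digit_sum M p / 3 - 1) / pi"
      using p(2) pi_gt_zero by (simp add: divide_simps)
    also have "\<dots> \<le> hilbert_transform dipoles x" by (rule hilbert_transform_dipoles_ge[OF p(1,3)])
    finally show "x \<in> ?H \<inter> support" using p by (auto simp: support_def)
  qed
  have "emeasure lebesgue ?U = (\<Sum>p\<in>?G. emeasure lebesgue (core M p))"
    by (intro sum_emeasure[symmetric] disjoint_cores) (auto simp: core_def)
  also have "\<dots> = (\<Sum>p\<in>?G. ennreal (1 / (3 * (3 * real M) ^ M)))"
    by (intro sum.cong refl) (simp add: emeasure_eq_measure2 core_lmeasurable measure_core)
  also have "\<dots> = ennreal (card ?G * (1 / (3 * (3 * real M) ^ M)))"
    by (simp add: ennreal_of_nat_eq_real_of_nat ennreal_mult[symmetric])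
  finally have U: "emeasure lebesgue ?U = ennreal (card ?G * (1 / (3 * (3 * real M) ^ M)))" .
  have "1/2 \<le> 3 ^ Suc M * (card ?G * (1 / (3 * (3 * real M) ^ M)))"
    using card_large_digit_sum P by (simp add: power_mult_distrib field_simps)
  then have "ennreal (1/2) \<le> ennreal (3 ^ Suc M * (card ?G * (1 / (3 * (3 * real M) ^ M))))"
    by (rule ennreal_leI)
  also have "\<dots> = ennreal (3 ^ Suc M) * emeasure lebesgue ?U"
    unfolding U by (rule ennreal_mult) simp_all
  also have "\<dots> = (\<integral>\<^sup>+x. ennreal (3 ^ Suc M) * indicator ?U x \<partial>lebesgue)"
    by (intro nn_integral_cmult_indicator[symmetric] sets.finite_UN) (auto simp: core_def)
  also have "\<dots> \<le> (\<integral>\<^sup>+x\<in>?H. ennreal (cantor_weight x) \<partial>lebesgue)"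
    using sub by (intro nn_integral_mono) (auto simp: cantor_weight_def split: split_indicator)
  finally show ?thesis by (simp add: weight_of_def)
qed

lemma cantor_weight_weight: "weight cantor_weight"
proof -
  have "cantor_weight \<in> borel_measurable borel"
    unfolding cantor_weight_def[abs_def] by measurable
  then show ?thesis
    by (auto simp: weight_def cantor_weight_def intro: measurable_completion)
qed

lemma dipoles_measurable: "dipoles \<in> borel_measurable lebesgue"
proof -
  have "dipoles \<in> borel_measurable borel"
    unfolding dipoles_def[abs_def] by measurable
  then show ?thesis by (auto intro: measurable_completion)
qed

end

theorem theorem1p1:
  fixes \<Phi> :: "real \<Rightarrow> real"
  assumes "young_function \<Phi>"
    and "((\<lambda>t. \<Phi> t / (t * ln (ln (exp (exp 1) + t)))) \<longlongrightarrow> 0) at_top"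
  shows "\<forall>c>0. \<exists>(f :: real \<Rightarrow> real) (w :: real \<Rightarrow> real) (lam :: real).
           weight w \<and> f \<in> borel_measurable lebesgue \<and>
           (\<integral>\<^sup>+x. ennreal \<bar>f x\<bar> * orlicz_maximal \<Phi> w x \<partial>lebesgue) < \<infinity> \<and>
           0 < lam \<and>
           weight_of w {x. \<bar>hilbert_transform f x\<bar> > lam}
             > ennreal (c / lam) *
               (\<integral>\<^sup>+x. ennreal \<bar>f x\<bar> * orlicz_maximal \<Phi> w x \<partial>lebesgue)"
proof (intro allI impI)
  fix c :: real assume c: "c > 0"
  \<comment> \<open>With this \<open>\<eta>\<close>, the part of \<open>c * A\<close> below that grows with \<open>M\<close> is \<open>0.042 * ln M\<close>, which is less than
    \<open>ln M\<close> divided by \<open>16 / 3 > 4 * pi / 3\<close>; the other terms are absorbed by taking \<open>ln M\<close> large.\<close>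
  define \<eta> where "\<eta> = 1 / (1000 * c)"
  have \<eta>: "\<eta> > 0" using c by (simp add: \<eta>_def)
  have "\<forall>\<^sub>F t in at_top. \<Phi> t / (t * ln (ln (exp (exp 1) + t))) < \<eta>"
    using order_tendstoD(2)[OF assms(2) \<eta>] .
  moreover have "filterlim (\<lambda>M. 3 ^ Suc M :: real) at_top sequentially" by real_asymp
  ultimately have "\<forall>\<^sub>F M in sequentially.
      \<Phi> (3 ^ Suc M) / (3 ^ Suc M * ln (ln (exp (exp 1) + 3 ^ Suc M))) < \<eta>"
    by (rule eventually_compose_filterlim)
  moreover have "\<forall>\<^sub>F M in sequentially. ln (ln (exp (exp 1) + 3 ^ Suc M)) \<le> 2 * ln (real M)"
    by real_asymp
  moreover have "filterlim (\<lambda>M. ln (real M)) at_top sequentially" by real_asymp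
  then have "\<forall>\<^sub>F M in sequentially. ln (real M) \<ge> 10 + 10 * c"
    by (simp add: filterlim_at_top)
  ultimately have "\<forall>\<^sub>F M in sequentially.
      \<Phi> (3 ^ Suc M) / (3 ^ Suc M * ln (ln (exp (exp 1) + 3 ^ Suc M))) < \<eta> \<and>
      ln (ln (exp (exp 1) + 3 ^ Suc M)) \<le> 2 * ln (real M) \<and> ln (real M) \<ge> 10 + 10 * c \<and> 0 < M"
    using eventually_gt_at_top[of 0] by (intro eventually_conj)
  then obtain M where
    M: "\<Phi> (3 ^ Suc M) / (3 ^ Suc M * ln (ln (exp (exp 1) + 3 ^ Suc M))) < \<eta>"
      "ln (ln (exp (exp 1) + 3 ^ Suc M)) \<le> 2 * ln (real M)" "ln (real M) \<ge> 10 + 10 * c" "0 < M"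
    unfolding eventually_sequentially by auto
  interpret digit_cantor M by unfold_locales (rule M(4))
  let ?T = "3 ^ Suc M :: real"
  \<comment> \<open>\<open>ln (ln (exp (exp 1) + T))\<close> is at most \<open>2 * ln M\<close>, so \<open>21 * \<Phi> T / T\<close> is at most \<open>42 * \<eta> * ln M\<close>.\<close>
  define A where "A = 1 + 42 * \<eta> * ln (real M)"
  define lam where "lam = (ln (real M) - 5) / (3 * pi)"
  have "exp (exp 1) < exp (exp 1) + ?T" by simp
  then have "ln (exp (exp 1)) < ln (exp (exp 1) + ?T)"
    by (subst ln_less_cancel_iff) (auto intro: add_pos_pos)
  then have "exp 1 < ln (exp (exp 1) + ?T)" by simp
  then have ll: "0 < ln (ln (exp (exp 1) + ?T))"
    using exp_ge_add_one_self[of 1] by (intro ln_gt_zero) linarith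
  have "\<Phi> ?T / ?T < \<eta> * ln (ln (exp (exp 1) + ?T))"
    using M(1) ll by (simp add: divide_simps mult_ac)
  also have "\<dots> \<le> \<eta> * (2 * ln (real M))" using M(2) \<eta> by (intro mult_left_mono) auto
  finally have A: "21 * \<Phi> ?T / ?T \<le> A" "1 \<le> A"
    using M(3) c \<eta> by (auto simp: A_def)
  have lam: "lam > 0" using M(3) c by (simp add: lam_def)
  let ?N = "\<integral>\<^sup>+x. ennreal \<bar>dipoles x\<bar> * orlicz_maximal \<Phi> cantor_weight x \<partial>lebesgue"
  have N: "?N \<le> ennreal (2 * A / 9)" by (rule dipoles_norm_le[OF assms(1) A(2,1)])
  have "c * A = c + 42/1000 * ln (real M)" using c by (simp add: A_def \<eta>_def field_simps)
  moreover have "pi * (c * A) \<le> 4 * (c * A)"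
    using pi_less_4 c A by (intro mult_right_mono) auto
  moreover have "16 * (c + 42/1000 * ln (real M)) < 3 * (ln (real M) - 5)"
    using M(3) c by simp
  moreover have "4 * q < 3 * l" if "q \<le> 4 * r" "r = s" "16 * s < 3 * l" for q r s l :: real
    using that by linarith
  ultimately have "4 * (pi * (c * A)) < 3 * (ln (real M) - 5)" by blast
  then have "c / lam * (2 * A / 9) < 1/2"
    using M(3) c by (simp add: lam_def divide_simps mult_ac)
  have "ennreal (c / lam) * ?N \<le> ennreal (c / lam) * ennreal (2 * A / 9)"
    by (intro mult_left_mono N) auto
  also have "\<dots> = ennreal (c / lam * (2 * A / 9))"
    using c lam A by (intro ennreal_mult[symmetric]) auto
  also have "\<dots> < ennreal (1/2)"
    using \<open>c / lam * (2 * A / 9) < 1/2\<close> by (intro ennreal_lessI) auto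
  also have "\<dots> \<le> weight_of cantor_weight {x. \<bar>hilbert_transform dipoles x\<bar> > lam}"
    unfolding lam_def by (rule weight_of_superlevel_ge)
  finally have "ennreal (c / lam) * ?N < weight_of cantor_weight {x. \<bar>hilbert_transform dipoles x\<bar> > lam}" .
  moreover have "?N < \<infinity>"
    using N by (simp add: order_le_less_trans[OF _ ennreal_less_top])
  ultimately show "\<exists>f w lam. weight w \<and> f \<in> borel_measurable lebesgue \<and>
       (\<integral>\<^sup>+x. ennreal \<bar>f x\<bar> * orlicz_maximal \<Phi> w x \<partial>lebesgue) < \<infinity> \<and> 0 < lam \<and>
       ennreal (c / lam) * (\<integral>\<^sup>+x. ennreal \<bar>f x\<bar> * orlicz_maximal \<Phi> w x \<partial>lebesgue)
       < weight_of w {x. lam < \<bar>hilbert_transform f x\<bar>}"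
    using cantor_weight_weight dipoles_measurable lam by blast
qed

end
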